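(* Let $d\ge 1$ and let $\mathcal{F}$ be a family of axis-parallel boxes in $\mathbb{R}^d$. If among every $\aleph_0$ of them some $2$ can be intersected with an axis-parallel hyperplane, then all the members of $\mathcal{F}$ can be hit by finitely many axis-parallel hyperplanes.
   Context: An axis-parallel box in $\mathbb{R}^d$ is a set $[a_1,b_1]\times\cdots\times[a_d,b_d]$ with real $a_i\le b_i$. An axis-parallel hyperplane is a set $\{x\in\mathbb{R}^d : x_i=c\}$ for some $i\in\{1,\dots,d\}$ and $c\in\mathbb{R}$. A hyperplane hits a set if it intersects it. The hypothesis means that every infinite subfamily of $\mathcal{F}$ contains two distinct boxes intersected by one common axis-parallel hyperplane. *)

theory Defs
  imports "HOL-Analysis.Analysis"
begin

definition axis_parallel_box :: "(real ^ 'n) set \<Rightarrow> bool" where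
  "axis_parallel_box B \<longleftrightarrow> (\<exists>a b. (\<forall>i. a $ i \<le> b $ i) \<and> B = cbox a b)"

definition axis_parallel_hyperplane :: "(real ^ 'n) set \<Rightarrow> bool" where
  "axis_parallel_hyperplane H \<longleftrightarrow> (\<exists>i c. H = {x. x $ i = c})"

definition hits :: "'a set \<Rightarrow> 'a set \<Rightarrow> bool" where
  "hits H B \<longleftrightarrow> H \<inter> B \<noteq> {}"

end

theory Submission imports Defs begin

text \<open>
  Call a family small if finitely many axis-parallel hyperplanes hit all its members; small families
  form an ideal. Compactify space by applying \<open>arctan\<close> to every coordinate. If \<open>F\<close> is not small,
  compactness yields a point \<open>p\<close> of the cube such that for each of its neighbourhoods the boxes of
  \<open>F\<close> inside it still form a non-small family, because a box that straddles the boundary of one of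
  finitely many cubes is hit by one of finitely many hyperplanes. Inside each neighbourhood there
  is then a box that no hyperplane \<open>x\<^sub>i = p\<^sub>i\<close> hits, so its projections keep a positive distance
  from the \<open>p\<^sub>i\<close>. Choosing boxes closer and closer to \<open>p\<close> gives infinitely many boxes, no two of
  which are hit by a common axis-parallel hyperplane.
\<close>

definition finitely_hittable :: "(real ^ 'n) set set \<Rightarrow> bool" where
  "finitely_hittable F \<longleftrightarrow>
    (\<exists>\<H>. finite \<H> \<and> (\<forall>H\<in>\<H>. axis_parallel_hyperplane H) \<and> (\<forall>B\<in>F. \<exists>H\<in>\<H>. hits H B))"

lemma finitely_hittable_subset:
  "finitely_hittable G \<Longrightarrow> F \<subseteq> G \<Longrightarrow> finitely_hittable F"
  unfolding finitely_hittable_def by blast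

lemma finitely_hittable_Un:
  assumes "finitely_hittable F" "finitely_hittable G"
  shows "finitely_hittable (F \<union> G)"
proof -
  obtain \<H> where "finite \<H>" "\<forall>H\<in>\<H>. axis_parallel_hyperplane H" "\<forall>B\<in>F. \<exists>H\<in>\<H>. hits H B"
    using assms(1) unfolding finitely_hittable_def by blast
  moreover obtain \<K> where "finite \<K>" "\<forall>H\<in>\<K>. axis_parallel_hyperplane H" "\<forall>B\<in>G. \<exists>H\<in>\<K>. hits H B"
    using assms(2) unfolding finitely_hittable_def by blast
  ultimately show ?thesis
    unfolding finitely_hittable_def by (intro exI[of _ "\<H> \<union> \<K>"]) blast
qed

lemma finitely_hittable_UN:
  assumes "finite D" "\<And>p. p \<in> D \<Longrightarrow> finitely_hittable (G p)"
  shows "finitely_hittable (\<Union>p\<in>D. G p)"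
  using assms
proof (induction D rule: finite_induct)
  case empty
  then show ?case unfolding finitely_hittable_def by auto
next
  case (insert p D)
  then show ?case by (simp add: finitely_hittable_Un)
qed

lemma finitely_hittable_coordinate_hyperplane:
  "finitely_hittable {B. hits {x. x $ i = c} B}"
  unfolding finitely_hittable_def axis_parallel_hyperplane_def
  by (rule exI[of _ "{{x. x $ i = c}}"]) auto

text \<open>A box is a product of intervals, so overwriting coordinate \<open>i\<close> of
  \<open>x\<close> by a value between \<open>x $ i\<close> and \<open>y $ i\<close> stays in
  \<open>B\<close>. The bounds are on the \<open>arctan\<close> scale, where the covering cubes
  live; they force \<open>u\<close> into the open interval on which \<open>arctan\<close> inverts
  \<open>tan\<close>.\<close>

lemma axis_parallel_box_hits_between:
  assumes "axis_parallel_box B" "x \<in> B" "y \<in> B"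
    and "arctan (x $ i) \<le> u" "u \<le> arctan (y $ i)"
  shows "hits {z. z $ i = tan u} B"
proof -
  obtain a b where B: "B = cbox a b"
    using assms(1) unfolding axis_parallel_box_def by blast
  have "arctan (tan u) = u"
    using assms(4,5) arctan_lbound[of "x $ i"] arctan_ubound[of "y $ i"]
    by (intro arctan_tan) linarith+
  then have "x $ i \<le> tan u" "tan u \<le> y $ i"
    using assms(4,5) by (metis arctan_le_iff)+
  then have "(\<chi> j. if j = i then tan u else x $ j) \<in> B"
    using assms(2,3) unfolding B mem_box_cart by (auto intro: order_trans)
  then show ?thesis
    unfolding hits_def by force
qed

text \<open>Coordinates of \<open>p\<close> are on the \<open>arctan\<close> scale:
  \<open>pi / 2\<close> and \<open>- (pi / 2)\<close> stand for infinity, so boxes that escape to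
  infinity cluster as well.\<close>

lemma not_finitely_hittable_cluster_point:
  fixes F :: "(real ^ 'n) set set"
  assumes boxes: "\<And>B. B \<in> F \<Longrightarrow> axis_parallel_box B" and "\<not> finitely_hittable F"
  obtains p :: "real ^ 'n" where
    "\<And>e. e > 0 \<Longrightarrow> \<not> finitely_hittable {B\<in>F. \<forall>x\<in>B. \<forall>i. \<bar>arctan (x $ i) - p $ i\<bar> < e}"
proof -
  define N where "N e p = {B\<in>F. \<forall>x\<in>B. \<forall>i. \<bar>arctan (x $ i) - p $ i\<bar> < e}"
    for e and p :: "real ^ 'n"
  have "\<exists>p. \<forall>e>0. \<not> finitely_hittable (N e p)"
  proof (rule ccontr)
    assume "\<nexists>p. \<forall>e>0. \<not> finitely_hittable (N e p)"
    then obtain e where e: "\<And>p. e p > 0" "\<And>p. finitely_hittable (N (e p) p)"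
      by metis
    define U where "U p = box (\<chi> i. p $ i - e p) (\<chi> i. p $ i + e p)" for p
    define K :: "(real ^ 'n) set" where "K = cbox (\<chi> i. - (pi / 2)) (\<chi> i. pi / 2)"
    have "compact K" unfolding K_def by (rule compact_cbox)
    moreover have "K \<subseteq> (\<Union>p\<in>K. U p)"
    proof
      fix p assume "p \<in> K"
      moreover have "p \<in> U p" using e(1)[of p] by (simp add: U_def mem_box_cart)
      ultimately show "p \<in> (\<Union>p\<in>K. U p)" by blast
    qed
    ultimately obtain D where D: "finite D" "K \<subseteq> (\<Union>p\<in>D. U p)"
      using compactE_image[of K K U] U_def open_box by metis
    \<comment> \<open>\<open>tan\<close> carries the faces of the cube around \<open>p\<close> back
      to hyperplanes in the original space. A face beyond the range of \<open>arctan\<close>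
      contributes some arbitrary hyperplane, which does no harm to finiteness.\<close>
    define E where "E p = N (e p) p \<union>
      (\<Union>i\<in>UNIV. {B. hits {x. x $ i = tan (p $ i - e p)} B}
        \<union> {B. hits {x. x $ i = tan (p $ i + e p)} B})" for p
    have "finitely_hittable (\<Union>p\<in>D. E p)"
      unfolding E_def
      by (intro finitely_hittable_UN finitely_hittable_Un finitely_hittable_coordinate_hyperplane
          D(1) e(2) finite)
    moreover have "F \<subseteq> (\<Union>p\<in>D. E p)"
    proof
      fix B assume B: "B \<in> F"
      then obtain x where x: "x \<in> B"
        using boxes[OF B] unfolding axis_parallel_box_def by (metis ex_in_conv interval_ne_empty_cart(1))
      have "(\<chi> i. arctan (x $ i)) \<in> K"
        unfolding K_def mem_box_cart
        using arctan_bounded by (auto simp: less_imp_le)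
      then obtain p where p: "p \<in> D" "(\<chi> i. arctan (x $ i)) \<in> U p"
        using D(2) by blast
      then have px: "p $ i - e p < arctan (x $ i)" "arctan (x $ i) < p $ i + e p" for i
        by (auto simp: U_def mem_box_cart)
      have "B \<in> E p"
      proof (cases "B \<in> N (e p) p")
        case True
        then show ?thesis by (simp add: E_def)
      next
        case False
        then obtain y i where "y \<in> B" "\<not> \<bar>arctan (y $ i) - p $ i\<bar> < e p"
          using B by (auto simp: N_def)
        then consider "arctan (y $ i) \<le> p $ i - e p" | "p $ i + e p \<le> arctan (y $ i)"
          by linarith
        \<comment> \<open>\<open>x\<close> lies inside the cube and \<open>y\<close> on or beyond a
          face orthogonal to axis \<open>i\<close>, so \<open>B\<close> meets the hyperplane of that
          face.\<close>
        then have "hits {x. x $ i = tan (p $ i - e p)} B \<or> hits {x. x $ i = tan (p $ i + e p)} B"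
        proof cases
          case 1
          then show ?thesis
            using axis_parallel_box_hits_between[OF boxes[OF B] \<open>y \<in> B\<close> x] px(1)[of i] by simp
        next
          case 2
          then show ?thesis
            using axis_parallel_box_hits_between[OF boxes[OF B] x \<open>y \<in> B\<close>] px(2)[of i] by simp
        qed
        then show ?thesis by (auto simp: E_def)
      qed
      then show "B \<in> (\<Union>p\<in>D. E p)" using p(1) by blast
    qed
    ultimately show False
      using assms(2) finitely_hittable_subset by blast
  qed
  then show ?thesis using that unfolding N_def by blast
qed

text \<open>By compactness each \<open>arctan\<close> projection of \<open>B\<close> is closed,
  hence at positive distance from any value it omits; finitely many coordinates allow a common
  minimum. Values such as \<open>pi / 2\<close> are omitted because \<open>arctan\<close> never
  attains them.\<close>

lemma axis_parallel_box_projections_avoid: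
  fixes p :: "real ^ 'n"
  assumes box: "axis_parallel_box B" and avoid: "\<And>i. \<not> hits {x. x $ i = tan (p $ i)} B"
  obtains d where "d > 0" "\<And>x i. x \<in> B \<Longrightarrow> d \<le> \<bar>arctan (x $ i) - p $ i\<bar>"
proof -
  have "\<exists>d>0. \<forall>x\<in>B. d \<le> \<bar>arctan (x $ i) - p $ i\<bar>" for i
  proof -
    let ?S = "(\<lambda>x. arctan (x $ i)) ` B"
    have "compact B"
      using box unfolding axis_parallel_box_def by (metis compact_cbox)
    then have "closed ?S"
      by (intro compact_imp_closed compact_continuous_image continuous_intros)
    moreover have "p $ i \<notin> ?S"
    proof
      assume "p $ i \<in> ?S"
      then obtain x where "x \<in> B" "arctan (x $ i) = p $ i" by auto
      \<comment> \<open>Both endpoints are taken to be \<open>x\<close>, through which the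
        hyperplane passes.\<close>
      then have "hits {x. x $ i = tan (p $ i)} B"
        using axis_parallel_box_hits_between[OF box] by (metis order_refl)
      then show False using avoid by blast
    qed
    ultimately obtain d where "d > 0" "\<forall>y\<in>?S. d \<le> dist (p $ i) y"
      using separate_point_closed by blast
    then show ?thesis by (auto simp: dist_real_def abs_minus_commute)
  qed
  then obtain d where d: "\<And>i. d i > 0" "\<And>i x. x \<in> B \<Longrightarrow> d i \<le> \<bar>arctan (x $ i) - p $ i\<bar>"
    by metis
  show ?thesis
  proof
    show "Min (range d) > 0" using d(1) by simp
    show "Min (range d) \<le> \<bar>arctan (x $ i) - p $ i\<bar>" if "x \<in> B" for x i
      using d(2)[OF that, of i] by (meson Min_le finite finite_imageI order_trans rangeI)
  qed
qed

theorem corollary9: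
  fixes F :: "(real ^ 'n) set set"
  assumes boxes: "\<And>B. B \<in> F \<Longrightarrow> axis_parallel_box B"
    and infinite_two: "\<And>G. G \<subseteq> F \<Longrightarrow> infinite G \<Longrightarrow>
      \<exists>A\<in>G. \<exists>B\<in>G. A \<noteq> B \<and> (\<exists>H. axis_parallel_hyperplane H \<and> hits H A \<and> hits H B)"
  shows "\<exists>\<H>. finite \<H> \<and> (\<forall>H\<in>\<H>. axis_parallel_hyperplane H) \<and> (\<forall>B\<in>F. \<exists>H\<in>\<H>. hits H B)"
proof (rule ccontr)
  assume "\<not> ?thesis"
  then have "\<not> finitely_hittable F" unfolding finitely_hittable_def .
  then obtain p where p: "\<And>e. e > 0 \<Longrightarrow>
      \<not> finitely_hittable {B\<in>F. \<forall>x\<in>B. \<forall>i. \<bar>arctan (x $ i) - p $ i\<bar> < e}"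
    using not_finitely_hittable_cluster_point[OF boxes] by blast
  \<comment> \<open>If \<open>far A d\<close> and \<open>near B d\<close>, then \<open>A\<close> and
    \<open>B\<close> have disjoint projections to every axis, so no axis-parallel hyperplane hits
    both.\<close>
  define far where "far B d \<longleftrightarrow> (\<forall>x\<in>B. \<forall>i. d \<le> \<bar>arctan (x $ i) - p $ i\<bar>)" for B d
  define near where "near B d \<longleftrightarrow> (\<forall>x\<in>B. \<forall>i. \<bar>arctan (x $ i) - p $ i\<bar> < d)" for B d
  have next_box: "\<exists>B d. B \<in> F \<and> d > 0 \<and> far B d \<and> near B e" if "e > 0" for e
  proof -
    have "finitely_hittable (\<Union>i\<in>UNIV. {B. hits {x. x $ i = tan (p $ i)} B})"
      by (intro finitely_hittable_UN finitely_hittable_coordinate_hyperplane finite)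
    then have "\<not> {B\<in>F. near B e} \<subseteq> (\<Union>i\<in>UNIV. {B. hits {x. x $ i = tan (p $ i)} B})"
      using p[OF that] finitely_hittable_subset unfolding near_def by blast
    then obtain B where B: "B \<in> F" "near B e" "\<And>i. \<not> hits {x. x $ i = tan (p $ i)} B"
      by blast
    then show ?thesis
      using axis_parallel_box_projections_avoid[OF boxes[OF B(1)] B(3)]
      unfolding far_def by metis
  qed
  \<comment> \<open>Each term pairs a box with a distance that it keeps from \<open>p\<close>, and
    the next box must fit within that distance. Monotone distances extend the separation to
    non-consecutive boxes.\<close>
  have "\<exists>f. \<forall>n. (fst (f n) \<in> F \<and> 0 < snd (f n) \<and> far (fst (f n)) (snd (f n))) \<and>
      (near (fst (f (Suc n))) (snd (f n)) \<and> snd (f (Suc n)) \<le> snd (f n))"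
  proof (rule dependent_nat_choice)
    show "\<exists>x. fst x \<in> F \<and> 0 < snd x \<and> far (fst x) (snd x)"
      using next_box[of 1] by auto
  next
    fix x and n :: nat
    assume "fst x \<in> F \<and> 0 < snd x \<and> far (fst x) (snd x)"
    then obtain B d where "B \<in> F" "d > 0" "far B d" "near B (snd x)"
      using next_box by blast
    \<comment> \<open>Capping \<open>d\<close> by the previous distance gives the monotonicity;
      \<open>far\<close> survives shrinking the distance.\<close>
    moreover have "far B (min d (snd x))"
      using \<open>far B d\<close> unfolding far_def by (meson min.coboundedI1)
    ultimately show "\<exists>y. (fst y \<in> F \<and> 0 < snd y \<and> far (fst y) (snd y)) \<and>
        near (fst y) (snd x) \<and> snd y \<le> snd x"
      using \<open>fst x \<in> F \<and> _\<close> by (intro exI[of _ "(B, min d (snd x))"]) auto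
  qed
  then obtain f where f: "\<And>n. fst (f n) \<in> F" "\<And>n. far (fst (f n)) (snd (f n))"
      "\<And>n. near (fst (f (Suc n))) (snd (f n))" "\<And>n. snd (f (Suc n)) \<le> snd (f n)"
    by blast
  have disjoint: False
    if "m < n" "x \<in> fst (f m)" "y \<in> fst (f n)" "x $ i = y $ i" for m n x y i
  proof -
    \<comment> \<open>The box with index \<open>n\<close> is near \<open>p\<close> by the distance
      stored at its predecessor \<open>k\<close>, not at \<open>n\<close>.\<close>
    obtain k where k: "n = Suc k" "m \<le> k" using \<open>m < n\<close> by (cases n) auto
    have "snd (f k) \<le> snd (f m)"
      using lift_Suc_antimono_le[of "\<lambda>n. snd (f n)"] f(4) k(2) by blast
    moreover have "snd (f m) \<le> \<bar>arctan (x $ i) - p $ i\<bar>"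
      using f(2) that(2) unfolding far_def by blast
    moreover have "\<bar>arctan (y $ i) - p $ i\<bar> < snd (f k)"
      using f(3) that(3) k(1) unfolding near_def by blast
    ultimately show False using that(4) by simp
  qed
  have nonempty: "fst (f n) \<noteq> {}" for n
    using boxes[OF f(1)[of n]] unfolding axis_parallel_box_def
    by (metis interval_ne_empty_cart(1))
  \<comment> \<open>The hypothesis needs infinitely many boxes, not just indices; equal nonempty
    boxes would share a point and contradict \<open>disjoint\<close>.\<close>
  have "inj (\<lambda>n. fst (f n))"
  proof (rule linorder_injI)
    fix m n :: nat
    assume "m < n"
    then show "fst (f m) \<noteq> fst (f n)"
      using disjoint nonempty by (metis ex_in_conv)
  qed
  then have "infinite (range (\<lambda>n. fst (f n)))"
    by (rule range_inj_infinite)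
  then obtain m n H where "fst (f m) \<noteq> fst (f n)" and H: "axis_parallel_hyperplane H"
      "hits H (fst (f m))" "hits H (fst (f n))"
    using infinite_two[of "range (\<lambda>n. fst (f n))"] f(1) by blast
  then have "m < n \<or> n < m" using nat_neq_iff by blast
  moreover obtain i c where "H = {x. x $ i = c}"
    using H(1) unfolding axis_parallel_hyperplane_def by blast
  then obtain x y where "x \<in> fst (f m)" "y \<in> fst (f n)" "x $ i = c" "y $ i = c"
    using H(2,3) unfolding hits_def by blast
  ultimately show False using disjoint by metis
qed

end
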